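(* For every $2$-dimensional real affine subspace $P$ of $\mathbb{H}\simeq\mathbb{R}^4$, there exists an entire slice regular function $f:\mathbb{H}\to\mathbb{H}$ such that $f(\mathbb{H})=\mathbb{H}\setminus P$. In particular, for every triple $q_1,q_2,q_3\in\mathbb{H}$ there is an entire slice regular function $f:\mathbb{H}\to\mathbb{H}$ avoiding these three values, i.e. with $f(\mathbb{H})\subset\mathbb{H}\setminus\{q_1,q_2,q_3\}$.
   Context: $\mathbb{H}$ denotes the skew field of quaternions, regarded as a $4$-dimensional real vector space. An entire slice regular function $f:\mathbb{H}\to\mathbb{H}$ is a function given by a globally convergent power series $f(q)=\sum_{k=0}^{\infty}q^k a_k$ with coefficients $a_k\in\mathbb{H}$ (on the right). *)

theory Defs
  imports "HOL-Analysis.Analysis"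
begin

datatype quat = Quat (qRe: real) (qI: real) (qJ: real) (qK: real)

lemma quat_eq_iff:
  "x = y \<longleftrightarrow> qRe x = qRe y \<and> qI x = qI y \<and> qJ x = qJ y \<and> qK x = qK y"
  by (cases x; cases y) auto

instantiation quat :: ring_1
begin

definition zero_quat :: quat where "0 = Quat 0 0 0 0"
definition one_quat :: quat where "1 = Quat 1 0 0 0"
definition plus_quat :: "quat \<Rightarrow> quat \<Rightarrow> quat" where
  "x + y = Quat (qRe x + qRe y) (qI x + qI y) (qJ x + qJ y) (qK x + qK y)"
definition uminus_quat :: "quat \<Rightarrow> quat" where
  "- x = Quat (- qRe x) (- qI x) (- qJ x) (- qK x)"
definition minus_quat :: "quat \<Rightarrow> quat \<Rightarrow> quat" where
  "x - y = Quat (qRe x - qRe y) (qI x - qI y) (qJ x - qJ y) (qK x - qK y)"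
definition times_quat :: "quat \<Rightarrow> quat \<Rightarrow> quat" where
  "x * y = Quat
     (qRe x * qRe y - qI x * qI y - qJ x * qJ y - qK x * qK y)
     (qRe x * qI y + qI x * qRe y + qJ x * qK y - qK x * qJ y)
     (qRe x * qJ y - qI x * qK y + qJ x * qRe y + qK x * qI y)
     (qRe x * qK y + qI x * qJ y - qJ x * qI y + qK x * qRe y)"

instance
  by standard (simp_all add: quat_eq_iff zero_quat_def one_quat_def plus_quat_def
      uminus_quat_def minus_quat_def times_quat_def algebra_simps)

end

lemma quat_zero_sel [simp]: "qRe 0 = 0" "qI 0 = 0" "qJ 0 = 0" "qK 0 = 0"
  by (simp_all add: zero_quat_def)

lemma quat_one_sel [simp]: "qRe 1 = 1" "qI 1 = 0" "qJ 1 = 0" "qK 1 = 0"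
  by (simp_all add: one_quat_def)

lemma quat_plus_sel [simp]:
  "qRe (x + y) = qRe x + qRe y" "qI (x + y) = qI x + qI y"
  "qJ (x + y) = qJ x + qJ y" "qK (x + y) = qK x + qK y"
  by (simp_all add: plus_quat_def)

lemma quat_uminus_sel [simp]:
  "qRe (- x) = - qRe x" "qI (- x) = - qI x" "qJ (- x) = - qJ x" "qK (- x) = - qK x"
  by (simp_all add: uminus_quat_def)

lemma quat_minus_sel [simp]:
  "qRe (x - y) = qRe x - qRe y" "qI (x - y) = qI x - qI y"
  "qJ (x - y) = qJ x - qJ y" "qK (x - y) = qK x - qK y"
  by (simp_all add: minus_quat_def)

lemma quat_times_sel:
  "qRe (x * y) = qRe x * qRe y - qI x * qI y - qJ x * qJ y - qK x * qK y"
  "qI (x * y) = qRe x * qI y + qI x * qRe y + qJ x * qK y - qK x * qJ y"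
  "qJ (x * y) = qRe x * qJ y - qI x * qK y + qJ x * qRe y + qK x * qI y"
  "qK (x * y) = qRe x * qK y + qI x * qJ y - qJ x * qI y + qK x * qRe y"
  by (simp_all add: times_quat_def)

instantiation quat :: real_algebra_1
begin

definition scaleR_quat :: "real \<Rightarrow> quat \<Rightarrow> quat" where
  "scaleR r x = Quat (r * qRe x) (r * qI x) (r * qJ x) (r * qK x)"

instance
  by standard (simp_all add: quat_eq_iff scaleR_quat_def quat_times_sel algebra_simps)

end

lemma quat_scaleR_sel [simp]:
  "qRe (r *\<^sub>R x) = r * qRe x" "qI (r *\<^sub>R x) = r * qI x"
  "qJ (r *\<^sub>R x) = r * qJ x" "qK (r *\<^sub>R x) = r * qK x"
  by (simp_all add: scaleR_quat_def)

instantiation quat :: real_normed_vector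
begin

definition norm_quat :: "quat \<Rightarrow> real" where
  "norm x = sqrt ((qRe x)\<^sup>2 + (qI x)\<^sup>2 + (qJ x)\<^sup>2 + (qK x)\<^sup>2)"
definition sgn_quat :: "quat \<Rightarrow> quat" where
  "sgn (x::quat) = x /\<^sub>R norm x"
definition dist_quat :: "quat \<Rightarrow> quat \<Rightarrow> real" where
  "dist (x::quat) y = norm (x - y)"
definition uniformity_quat :: "(quat \<times> quat) filter" where
  "uniformity = (INF e\<in>{0 <..}. principal {(x::quat, y). dist x y < e})"
definition open_quat :: "quat set \<Rightarrow> bool" where
  "open (U :: quat set) \<longleftrightarrow> (\<forall>x\<in>U. eventually (\<lambda>(x', y). x' = x \<longrightarrow> y \<in> U) uniformity)"

instance
proof
  fix x y :: quat and r :: real and U :: "quat set"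
  have L2: "norm z = norm ((qRe z, qI z), (qJ z, qK z))" for z :: quat
    by (simp add: norm_quat_def norm_prod_def)
  show "norm x = 0 \<longleftrightarrow> x = 0"
    by (simp add: L2 quat_eq_iff prod_eq_iff zero_prod_def)
  show "norm (x + y) \<le> norm x + norm y"
    using norm_triangle_ineq[of "((qRe x, qI x), (qJ x, qK x))" "((qRe y, qI y), (qJ y, qK y))"]
    by (simp add: L2)
  show "norm (r *\<^sub>R x) = \<bar>r\<bar> * norm x"
    using norm_scaleR[of r "((qRe x, qI x), (qJ x, qK x))"] by (simp add: L2)
qed (fact dist_quat_def sgn_quat_def uniformity_quat_def open_quat_def)+

end

instantiation quat :: real_inner
begin

definition inner_quat :: "quat \<Rightarrow> quat \<Rightarrow> real" where
  "inner x y = qRe x * qRe y + qI x * qI y + qJ x * qJ y + qK x * qK y"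

instance
proof
  fix x y z :: quat and r :: real
  show "0 \<le> inner x x"
    by (simp add: inner_quat_def)
  show "inner x x = 0 \<longleftrightarrow> x = 0"
    by (simp add: inner_quat_def quat_eq_iff add_nonneg_eq_0_iff)
  show "norm x = sqrt (inner x x)"
    by (simp add: norm_quat_def inner_quat_def power2_eq_square)
qed (simp_all add: inner_quat_def algebra_simps)

end

lemma quat_norm_power2: "(norm (x :: quat))\<^sup>2 = (qRe x)\<^sup>2 + (qI x)\<^sup>2 + (qJ x)\<^sup>2 + (qK x)\<^sup>2"
  by (simp add: norm_quat_def)

lemma quat_mult_conjugate:
  "Quat (qRe x) (- qI x) (- qJ x) (- qK x) * x = (norm x)\<^sup>2 *\<^sub>R 1"
  "x * Quat (qRe x) (- qI x) (- qJ x) (- qK x) = (norm x)\<^sup>2 *\<^sub>R 1"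
  unfolding quat_norm_power2
  by (simp_all add: quat_eq_iff quat_times_sel power2_eq_square)

instantiation quat :: real_normed_div_algebra
begin

definition inverse_quat :: "quat \<Rightarrow> quat" where
  "inverse (x::quat) = Quat (qRe x) (- qI x) (- qJ x) (- qK x) /\<^sub>R (norm x)\<^sup>2"
definition divide_quat :: "quat \<Rightarrow> quat \<Rightarrow> quat" where
  "divide (x::quat) y = x * inverse y"

instance
proof
  fix x y :: quat
  show "norm (x * y) = norm x * norm y"
  proof (rule power2_eq_imp_eq)
    show "(norm (x * y))\<^sup>2 = (norm x * norm y)\<^sup>2"
      unfolding power_mult_distrib quat_norm_power2 quat_times_sel by algebra
  qed simp_all
qed (simp_all add: inverse_quat_def divide_quat_def quat_mult_conjugate)

end

instantiation quat :: euclidean_space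
begin

definition Basis_quat :: "quat set" where
  "Basis = {Quat 1 0 0 0, Quat 0 1 0 0, Quat 0 0 1 0, Quat 0 0 0 1}"

instance
proof
  fix x :: quat
  show "(\<forall>u\<in>Basis. inner x u = 0) \<longleftrightarrow> x = 0"
    by (cases x) (simp add: Basis_quat_def inner_quat_def zero_quat_def)
qed (auto simp: Basis_quat_def inner_quat_def)

end

lemma DIM_quat: "DIM(quat) = 4"
  by (simp add: Basis_quat_def)

definition entire_slice_regular :: "(quat \<Rightarrow> quat) \<Rightarrow> bool" where
  "entire_slice_regular f \<longleftrightarrow> (\<exists>a :: nat \<Rightarrow> quat. \<forall>q. (\<lambda>k. q ^ k * a k) sums f q)"

end

theory Submission
  imports Defs
begin

text \<open>
  Let \<open>n1, n2\<close> be an orthonormal basis of the orthogonal complement of the direction of \<open>P\<close> and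
  let \<open>d \<in> P\<close>. The function \<open>f q = cos q * n1 + sin q * n2 + d\<close> has range \<open>UNIV - P\<close>.
  Indeed, for an imaginary unit \<open>I\<close>,
  \<open>f (x + y I) - d = cosh y m + sinh y (I m')\<close>, where \<open>(m, m')\<close> is the basis \<open>(n1, n2)\<close> rotated by
  the angle \<open>x\<close>. As \<open>I\<close> varies, \<open>I m'\<close> runs through all unit vectors orthogonal to \<open>m'\<close>.
  A vector \<open>w\<close> orthogonal to \<open>n1\<close> and \<open>n2\<close> is not attained, since it would satisfy
  \<open>(norm w)\<^sup>2 + (cosh y)\<^sup>2 = (sinh y)\<^sup>2\<close>; and \<open>w + r m\<close> with \<open>r > 0\<close> is attained at the
  \<open>y\<close> with \<open>(norm w)\<^sup>2 + (r - cosh y)\<^sup>2 = (sinh y)\<^sup>2\<close>, that is,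
  \<open>cosh y = ((norm w)\<^sup>2 + r\<^sup>2 + 1) / (2 r)\<close>.
\<close>

section \<open>Complex slices, and cosine and sine on them\<close>

lemma quat_imaginary_unit_square:
  fixes u :: quat
  assumes "qRe u = 0" "norm u = 1"
  shows "u * u = -1"
proof -
  have "(qI u)\<^sup>2 + (qJ u)\<^sup>2 + (qK u)\<^sup>2 = 1"
    using quat_norm_power2[of u] assms by simp
  then show ?thesis
    using assms(1) by (simp add: quat_eq_iff quat_times_sel power2_eq_square algebra_simps)
qed

lemma quat_eq_real_plus_imaginary:
  fixes q :: quat
  obtains x y :: real and u :: quat
  where "qRe u = 0" "norm u = 1" "q = of_real x + y *\<^sub>R u"
proof (cases "q = of_real (qRe q)")
  case True
  show ?thesis
    \<comment> \<open>A real \<open>q\<close> lies in every slice, so any imaginary unit serves,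
      with \<open>y = 0\<close>.\<close>
    using that[of "Quat 0 1 0 0" "qRe q" 0] True by (simp add: norm_quat_def)
next
  case False
  define v where "v = q - of_real (qRe q)"
  have "norm v > 0" using False by (simp add: v_def)
  moreover have "qRe v = 0" by (simp add: v_def of_real_def)
  ultimately show ?thesis
    using that[of "v /\<^sub>R norm v" "qRe q" "norm v"] by (simp add: v_def)
qed

context
  fixes u :: quat
  assumes u: "u * u = -1"
begin

text \<open>Since \<open>u * u = -1\<close>, this is a homomorphism of real algebras onto the slice
  through \<open>u\<close>. It carries complex identities over to quaternions.\<close>

definition complex_slice :: "complex \<Rightarrow> quat" where
  "complex_slice z = of_real (Re z) + Im z *\<^sub>R u"

lemma bounded_linear_complex_slice: "bounded_linear complex_slice"
  unfolding complex_slice_def of_real_def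
  by (intro bounded_linear_add bounded_linear_scaleR_const bounded_linear_Re bounded_linear_Im)

lemma complex_slice_mult: "complex_slice (z * w) = complex_slice z * complex_slice w"
  by (simp add: complex_slice_def algebra_simps u of_real_def)

lemma complex_slice_power: "complex_slice (z ^ n) = complex_slice z ^ n"
  by (induction n) (simp_all add: complex_slice_mult, simp add: complex_slice_def)

text \<open>A bounded linear multiplicative map passes through the series term by term, because the
  coefficients of cosine are real.\<close>

lemma cos_complex_slice: "cos (complex_slice z) = complex_slice (cos z)"
  using bounded_linear.sums[OF bounded_linear_complex_slice cos_converges[of z]]
    cos_converges[of "complex_slice z"]
  by (simp add: linear_scale[OF bounded_linear.linear[OF bounded_linear_complex_slice]]
      complex_slice_power sums_iff)

lemma sin_complex_slice: "sin (complex_slice z) = complex_slice (sin z)"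
  using bounded_linear.sums[OF bounded_linear_complex_slice sin_converges[of z]]
    sin_converges[of "complex_slice z"]
  by (simp add: linear_scale[OF bounded_linear.linear[OF bounded_linear_complex_slice]]
      complex_slice_power sums_iff)

lemma cos_quat:
  "cos (of_real x + y *\<^sub>R u) = of_real (cos x * cosh y) - (sin x * sinh y) *\<^sub>R u"
proof -
  have "Re (cos (Complex x y)) = cos x * cosh y" "Im (cos (Complex x y)) = - (sin x * sinh y)"
    by (simp_all add: Re_cos Im_cos cosh_field_def sinh_field_def field_simps)
  then show ?thesis
    using cos_complex_slice[of "Complex x y"] by (simp add: complex_slice_def)
qed

lemma sin_quat:
  "sin (of_real x + y *\<^sub>R u) = of_real (sin x * cosh y) + (cos x * sinh y) *\<^sub>R u"
proof -
  have "Re (sin (Complex x y)) = sin x * cosh y" "Im (sin (Complex x y)) = cos x * sinh y"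
    by (simp_all add: Re_sin Im_sin cosh_field_def sinh_field_def field_simps)
  then show ?thesis
    using sin_complex_slice[of "Complex x y"] by (simp add: complex_slice_def)
qed

text \<open>The three parameters separate: \<open>x\<close> only rotates the pair, \<open>y\<close>
  only scales, and \<open>u\<close> only multiplies from the left, which preserves norms when
  \<open>norm u = 1\<close>.\<close>

lemma cos_sin_quat_rotation:
  "cos (of_real x + y *\<^sub>R u) * n1 + sin (of_real x + y *\<^sub>R u) * n2 =
     cosh y *\<^sub>R (cos x *\<^sub>R n1 + sin x *\<^sub>R n2) +
     sinh y *\<^sub>R (u * (cos x *\<^sub>R n2 - sin x *\<^sub>R n1))"
  unfolding cos_quat sin_quat by (simp add: of_real_def algebra_simps)

end

section \<open>Regularity and range of the function\<close>

lemma entire_slice_regular_cos_sin: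
  "entire_slice_regular (\<lambda>q. cos q * n1 + sin q * n2 + d)"
proof -
  \<comment> \<open>Real coefficients commute with powers of \<open>q\<close>, so \<open>n1\<close>
    and \<open>n2\<close> can stay on the right; the constant \<open>d\<close> joins the coefficient
    of index 0.\<close>
  define a where "a k = cos_coeff k *\<^sub>R n1 + sin_coeff k *\<^sub>R n2 + (if k = 0 then d else 0)" for k
  have "(\<lambda>k. q ^ k * a k) sums (cos q * n1 + sin q * n2 + d)" for q
  proof -
    have "(\<lambda>k. (cos_coeff k *\<^sub>R q ^ k) * n1 + (sin_coeff k *\<^sub>R q ^ k) * n2 + (if k = 0 then d else 0))
        sums (cos q * n1 + sin q * n2 + d)"
      by (intro sums_add sums_mult2 cos_converges sin_converges)
        (use sums_single[of 0 "\<lambda>_. d"] in simp)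
    also have "(\<lambda>k. (cos_coeff k *\<^sub>R q ^ k) * n1 + (sin_coeff k *\<^sub>R q ^ k) * n2
        + (if k = 0 then d else 0)) = (\<lambda>k. q ^ k * a k)"
      by (auto simp: a_def fun_eq_iff algebra_simps)
    finally show ?thesis .
  qed
  then show ?thesis
    unfolding entire_slice_regular_def by blast
qed

lemma cos_sin_quat_avoids:
  fixes n1 n2 q w :: quat
  assumes n: "norm n1 = 1" "norm n2 = 1" "inner n1 n2 = 0"
    and w: "inner w n1 = 0" "inner w n2 = 0"
  shows "cos q * n1 + sin q * n2 \<noteq> w"
proof
  assume eq: "cos q * n1 + sin q * n2 = w"
  obtain x y u where u: "qRe u = 0" "norm u = 1" and q: "q = of_real x + y *\<^sub>R u"
    by (rule quat_eq_real_plus_imaginary)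
  define m where "m = cos x *\<^sub>R n1 + sin x *\<^sub>R n2"
  define m' where "m' = cos x *\<^sub>R n2 - sin x *\<^sub>R n1"
  have nn: "inner n1 n1 = 1" "inner n2 n2 = 1" "inner n2 n1 = 0"
    using n by (simp_all add: norm_eq_1 inner_commute)
  have m: "inner m m = 1" "inner m' m' = 1" "inner w m = 0"
    using sin_cos_squared_add3[of x] w
    by (simp_all add: m_def m'_def inner_simps n(3) nn)
  have "w = cosh y *\<^sub>R m + sinh y *\<^sub>R (u * m')"
    using eq cos_sin_quat_rotation[OF quat_imaginary_unit_square[OF u]]
    by (simp add: q m_def m'_def)
  \<comment> \<open>With the \<open>m\<close> term moved to the left, no inner product of
    \<open>m\<close> with \<open>u * m'\<close> arises: the left side is an orthogonal sum, and the
    right side has norm \<open>\<bar>sinh y\<bar>\<close>.\<close>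
  then have "w - cosh y *\<^sub>R m = sinh y *\<^sub>R (u * m')"
    by simp
  then have "(norm (w - cosh y *\<^sub>R m))\<^sup>2 = (norm (sinh y *\<^sub>R (u * m')))\<^sup>2"
    by simp
  also have "\<dots> = (sinh y)\<^sup>2"
    using u m by (simp add: norm_mult power_mult_distrib norm_eq_1[symmetric])
  also have "(norm (w - cosh y *\<^sub>R m))\<^sup>2 = (norm w)\<^sup>2 + (cosh y)\<^sup>2"
    unfolding power2_norm_eq_inner
    using m by (simp add: inner_simps inner_commute[of m w] power2_eq_square)
  finally show False
    using hyperbolic_pythagoras[of y] zero_le_power2[of "norm w"] by linarith
qed

text \<open>The inverse of \<open>m\<close> is a real multiple of its conjugate, and
  \<open>v\<close> times that conjugate has real part \<open>inner v m\<close>. This is what makes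
  the quotient usable as an imaginary unit.\<close>

lemma qRe_divide_orthogonal:
  fixes v m :: quat
  assumes "inner v m = 0"
  shows "qRe (v / m) = 0"
  using assms by (simp add: divide_quat_def inverse_quat_def quat_times_sel inner_quat_def)

lemma cos_sin_quat_attains:
  fixes n1 n2 p :: quat
  assumes n: "norm n1 = 1" "norm n2 = 1" "inner n1 n2 = 0"
    and p: "inner p n1 \<noteq> 0 \<or> inner p n2 \<noteq> 0"
  obtains q where "cos q * n1 + sin q * n2 = p"
proof -
  have nn: "inner n1 n1 = 1" "inner n2 n2 = 1" "inner n2 n1 = 0"
    using n by (simp_all add: norm_eq_1 inner_commute)
  \<comment> \<open>The polar form of the coordinates of \<open>p\<close> along \<open>n1\<close>
    and \<open>n2\<close> gives the angle \<open>x\<close> for which \<open>p\<close> has component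
    \<open>r\<close> along \<open>m\<close> and 0 along \<open>m'\<close>.\<close>
  define z where "z = Complex (inner p n1) (inner p n2)"
  define r where "r = norm z"
  define x where "x = Arg z"
  have r: "r > 0"
    using p by (auto simp: r_def z_def complex_eq_iff)
  have "z = rcis r x"
    by (simp add: r_def x_def rcis_cmod_Arg)
  then have pn: "inner p n1 = r * cos x" "inner p n2 = r * sin x"
    by (simp_all add: z_def complex_eq_iff)
  define m where "m = cos x *\<^sub>R n1 + sin x *\<^sub>R n2"
  define m' where "m' = cos x *\<^sub>R n2 - sin x *\<^sub>R n1"
  have m: "inner m m = 1" "inner m' m' = 1" "inner m m' = 0"
    using sin_cos_squared_add3[of x]
    by (simp_all add: m_def m'_def inner_simps n(3) nn)
  have pm': "inner p m' = 0"
    by (simp add: m'_def inner_simps pn)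
  have "inner p m = r * (cos x * cos x + sin x * sin x)"
    unfolding m_def inner_simps pn by algebra
  then have pm: "inner p m = r"
    using sin_cos_squared_add3[of x] by simp
  \<comment> \<open>The value of \<open>c\<close> solving
    \<open>(norm (p - c *\<^sub>R m))\<^sup>2 = c\<^sup>2 - 1\<close>, given
    \<open>inner p m = r\<close>. It is at least 1, hence a value of \<open>cosh\<close>, by
    Cauchy-Schwarz and \<open>(r - 1)\<^sup>2 \<ge> 0\<close>.\<close>
  define c where "c = ((norm p)\<^sup>2 + 1) / (2 * r)"
  have "r\<^sup>2 \<le> (norm p)\<^sup>2"
    using Cauchy_Schwarz_ineq[of p m] m pm by (simp add: power2_norm_eq_inner)
  then have "2 * r \<le> (norm p)\<^sup>2 + 1"
    using zero_le_power2[of "r - 1"] by (simp add: power2_diff)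
  then have c: "c \<ge> 1"
    using r by (simp add: c_def)
  define y where "y = arcosh c"
  have y: "cosh y = c"
    using c by (simp add: y_def)
  have sinh: "(sinh y)\<^sup>2 = c\<^sup>2 - 1"
    using hyperbolic_pythagoras[of y] y by simp
  define v where "v = p - c *\<^sub>R m"
  have "(norm v)\<^sup>2 = (norm p)\<^sup>2 - 2 * c * r + c\<^sup>2"
    unfolding power2_norm_eq_inner
    using m pm by (simp add: v_def inner_simps inner_commute[of m p] power2_eq_square algebra_simps)
  also have "2 * c * r = (norm p)\<^sup>2 + 1"
    using r by (simp add: c_def)
  finally have nv: "(norm v)\<^sup>2 = (sinh y)\<^sup>2"
    using sinh by simp
  have vm': "inner v m' = 0"
    using m pm' by (simp add: v_def inner_simps)
  have m'1: "norm m' = 1"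
    using m by (simp add: norm_eq_1)
  obtain u where u: "qRe u = 0" "norm u = 1" and v: "v = sinh y *\<^sub>R (u * m')"
  proof (cases "sinh y = 0")
    case True
    then have "v = 0" using nv by simp
    then show ?thesis
      using that[of "Quat 0 1 0 0"] True by (simp add: norm_quat_def)
  next
    case False
    have "norm v = \<bar>sinh y\<bar>"
      by (rule power2_eq_imp_eq) (simp_all add: nv)
    moreover have "qRe (v / m') = 0"
      using vm' by (rule qRe_divide_orthogonal)
    moreover have "v / m' * m' = v"
    proof -
      have "m' \<noteq> 0" using m'1 by auto
      then show ?thesis by (simp add: divide_inverse mult.assoc)
    qed
    ultimately show ?thesis
      \<comment> \<open>Solving \<open>v = sinh y *\<^sub>R (u * m')\<close> for \<open>u\<close>:
        orthogonality of \<open>v\<close> and \<open>m'\<close> makes \<open>u\<close> imaginary,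
        and the choice of \<open>c\<close> makes it a unit.\<close>
      using that[of "(v / m') /\<^sub>R sinh y"] False m'1
      by (simp add: divide_inverse norm_mult norm_inverse)
  qed
  have "p = cosh y *\<^sub>R m + sinh y *\<^sub>R (u * m')"
    using v y by (simp add: v_def algebra_simps)
  also have "\<dots> = cos (of_real x + y *\<^sub>R u) * n1 + sin (of_real x + y *\<^sub>R u) * n2"
    using cos_sin_quat_rotation[OF quat_imaginary_unit_square[OF u]] by (simp add: m_def m'_def)
  finally show ?thesis
    using that by metis
qed

lemma slice_regular_range:
  fixes n1 n2 d :: quat
  assumes "norm n1 = 1" "norm n2 = 1" "inner n1 n2 = 0"
  obtains f where "entire_slice_regular f"
    "range f = UNIV - {p. inner (p - d) n1 = 0 \<and> inner (p - d) n2 = 0}"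
proof
  let ?f = "\<lambda>q. cos q * n1 + sin q * n2 + d"
  show "entire_slice_regular ?f"
    by (rule entire_slice_regular_cos_sin)
  show "range ?f = UNIV - {p. inner (p - d) n1 = 0 \<and> inner (p - d) n2 = 0}"
  proof (intro equalityI subsetI)
    fix p assume "p \<in> range ?f"
    then obtain q where "cos q * n1 + sin q * n2 = p - d" by auto
    then show "p \<in> UNIV - {p. inner (p - d) n1 = 0 \<and> inner (p - d) n2 = 0}"
      using cos_sin_quat_avoids[OF assms, of "p - d" q] by auto
  next
    fix p assume "p \<in> UNIV - {p. inner (p - d) n1 = 0 \<and> inner (p - d) n2 = 0}"
    then obtain q where "cos q * n1 + sin q * n2 = p - d"
      using cos_sin_quat_attains[OF assms, of "p - d"] by auto
    then have "p = ?f q" by simp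
    then show "p \<in> range ?f" by blast
  qed
qed

section \<open>Normal vectors of a subspace, and the two claims\<close>

lemma orthonormal_pair_orthogonal_to_subspace:
  fixes S :: "'a::euclidean_space set"
  assumes "subspace S" "dim S + 2 \<le> DIM('a)"
  obtains n1 n2 where "norm n1 = 1" "norm n2 = 1" "inner n1 n2 = 0"
    "S \<subseteq> {v. inner v n1 = 0 \<and> inner v n2 = 0}"
    "dim S + 2 = DIM('a) \<longrightarrow> S = {v. inner v n1 = 0 \<and> inner v n2 = 0}"
proof -
  define C where "C = {y. \<forall>x\<in>S. orthogonal x y}"
  have C: "subspace C"
    using subspace_orthogonal_comp[of S] by (simp add: C_def orthogonal_comp_def)
  have "dim C + dim S = DIM('a)"
    using dim_subspace_orthogonal_to_vectors[OF assms(1) subspace_UNIV] by (simp add: C_def)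
  then have "2 \<le> dim C" using assms(2) by simp
  obtain B where B: "B \<subseteq> C" "pairwise orthogonal B" "\<And>x. x \<in> B \<Longrightarrow> norm x = 1"
      "independent B" "card B = dim C"
    using orthonormal_basis_subspace[OF C] by metis
  obtain N where N: "N \<subseteq> B" "card N = 2"
    using obtain_subset_with_card_n[of 2 B] \<open>2 \<le> dim C\<close> B(5) by metis
  then obtain n1 n2 where n: "N = {n1, n2}" "n1 \<noteq> n2"
    by (auto simp: card_2_iff)
  have mem: "n1 \<in> B" "n2 \<in> B" using N n by auto
  have n12: "inner n1 n2 = 0"
    using B(2) mem n(2) by (auto simp: pairwise_def orthogonal_def)
  have SN: "S \<subseteq> {v. inner v n1 = 0 \<and> inner v n2 = 0}"
    using mem B(1) by (auto simp: C_def orthogonal_def)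
  define T where "T = {v. inner v n1 = 0 \<and> inner v n2 = 0}"
  \<comment> \<open>By dimension: \<open>T\<close> contains \<open>S\<close> and is the complement
    of the two-dimensional \<open>span N\<close>, so both have dimension
    \<open>DIM('a) - 2\<close>.\<close>
  have "S = T" if "dim S + 2 = DIM('a)"
  proof (rule subspace_dim_equal)
    have Teq: "T = {y. \<forall>x\<in>span N. orthogonal x y}"
    proof (intro equalityI subsetI)
      fix v assume "v \<in> T"
      then have "\<And>x. x \<in> N \<Longrightarrow> orthogonal v x"
        using n by (auto simp: T_def orthogonal_def)
      then have "\<And>x. x \<in> span N \<Longrightarrow> orthogonal v x"
        using orthogonal_to_span by blast
      then show "v \<in> {y. \<forall>x\<in>span N. orthogonal x y}"
        by (simp add: orthogonal_commute)
    next
      fix v assume "v \<in> {y. \<forall>x\<in>span N. orthogonal x y}"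
      then show "v \<in> T"
        using n by (auto simp: T_def orthogonal_def span_base inner_commute)
    qed
    then show "subspace T"
      using subspace_orthogonal_comp[of "span N"] by (simp add: orthogonal_comp_def)
    have "dim T + dim (span N) = DIM('a)"
      using dim_subspace_orthogonal_to_vectors[OF subspace_span[of N] subspace_UNIV]
      by (simp add: Teq)
    moreover have "dim (span N) = 2"
      using N dim_eq_card_independent[OF independent_mono[OF B(4) N(1)]] by simp
    ultimately show "dim T \<le> dim S" using that by simp
    show "S \<subseteq> T" using SN by (auto simp: T_def)
  qed (fact assms(1))
  then show ?thesis
    using that[of n1 n2] mem B(3) n12 SN by (simp add: T_def)
qed

theorem mainTheorem1:
  shows "(\<forall>P :: quat set. affine P \<and> aff_dim P = 2 \<longrightarrow>
            (\<exists>f. entire_slice_regular f \<and> range f = UNIV - P)) \<and>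
         (\<forall>q1 q2 q3 :: quat. \<exists>f. entire_slice_regular f \<and> range f \<subseteq> UNIV - {q1, q2, q3})"
proof (intro conjI allI impI)
  fix P :: "quat set"
  assume P: "affine P \<and> aff_dim P = 2"
  then obtain d where d: "d \<in> P" by fastforce
  define S where "S = (\<lambda>x. x - d) ` P"
  have S: "subspace S"
    using affine_diffs_subspace_subtract[of P d] P d by (simp only: S_def)
  have dS: "dim S + 2 = DIM(quat)"
    using aff_dim_dim_affine_diffs[of P d] P d by (simp add: S_def DIM_quat)
  obtain n1 n2 where n: "norm n1 = 1" "norm n2 = 1" "inner n1 n2 = 0"
      "S \<subseteq> {v. inner v n1 = 0 \<and> inner v n2 = 0}"
      "dim S + 2 = DIM(quat) \<longrightarrow> S = {v. inner v n1 = 0 \<and> inner v n2 = 0}"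
    by (rule orthonormal_pair_orthogonal_to_subspace[OF S eq_refl[OF dS]])
  have "P = {p. inner (p - d) n1 = 0 \<and> inner (p - d) n2 = 0}"
  proof -
    have "p \<in> P \<longleftrightarrow> p - d \<in> S" for p by (auto simp: S_def)
    then show ?thesis using n(5) dS by auto
  qed
  then show "\<exists>f. entire_slice_regular f \<and> range f = UNIV - P"
    using slice_regular_range[OF n(1-3), of d] by metis
next
  fix q1 q2 q3 :: quat
  \<comment> \<open>The three points may be collinear or coincide, so \<open>S\<close> may have
    dimension below 2. Then the avoided plane merely contains \<open>q1 + S\<close>, which
    suffices.\<close>
  define S where "S = span {q2 - q1, q3 - q1}"
  have "dim S \<le> card {q2 - q1, q3 - q1}"
    unfolding S_def dim_span by (rule dim_le_card') simp
  also have "\<dots> \<le> 2" by (simp add: card_insert_if)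
  finally have dS: "dim S + 2 \<le> DIM(quat)" by (simp add: DIM_quat)
  have S: "subspace S"
    by (simp add: S_def)
  obtain n1 n2 where n: "norm n1 = 1" "norm n2 = 1" "inner n1 n2 = 0"
      "S \<subseteq> {v. inner v n1 = 0 \<and> inner v n2 = 0}"
      "dim S + 2 = DIM(quat) \<longrightarrow> S = {v. inner v n1 = 0 \<and> inner v n2 = 0}"
    by (rule orthonormal_pair_orthogonal_to_subspace[OF S dS])
  obtain f where f: "entire_slice_regular f"
      "range f = UNIV - {p. inner (p - q1) n1 = 0 \<and> inner (p - q1) n2 = 0}"
    using slice_regular_range[OF n(1-3), of q1] by metis
  have "q2 - q1 \<in> S" "q3 - q1 \<in> S"
    by (simp_all add: S_def span_base)
  then have "{q1, q2, q3} \<subseteq> {p. inner (p - q1) n1 = 0 \<and> inner (p - q1) n2 = 0}"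
    using n(4) by auto
  then show "\<exists>f. entire_slice_regular f \<and> range f \<subseteq> UNIV - {q1, q2, q3}"
    using f by blast
qed

end
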